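(* Let $n\ge k\ge1$ be integers. For any $\pi\in\mathcal P_n^k$, the statistics $\mathrm{INV}$ and $\mathrm{MAJ}$ are equidistributed on $\mathcal R(\pi)$ and $$\sum_{\pi'\in\mathcal R(\pi)}q^{\mathrm{MAJ}\,\pi'}=\sum_{\pi'\in\mathcal R(\pi)}q^{\mathrm{INV}\,\pi'}=[k]_q!.$$
   Context: $[n]=\{1,\dots,n\}$ and $S_k$ is the symmetric group on $[k]$. An ordered partition of $[n]$ into $k$ blocks is a sequence $B_1/B_2/\cdots/B_k$ of disjoint nonempty subsets (blocks) of $[n]$ whose union is $[n]$. $\mathcal P_n^k$ is the set of (unordered) set partitions of $[n]$ into $k$ blocks, each identified with the ordered partition $B_1/\cdots/B_k$ whose blocks are arranged in increasing order of their minima. For $\pi=B_1/\cdots/B_k\in\mathcal P_n^k$, its rearrangement class is $\mathcal R(\pi)=\{B_{\sigma(1)}/B_{\sigma(2)}/\cdots/B_{\sigma(k)}:\sigma\in S_k\}$. For an ordered partition $\pi'=C_1/\cdots/C_k$ and $i\in[n]$, $\mathrm{rsb}_i(\pi')$ is the number of blocks of $\pi'$ to the right of the block containing $i$ whose least element is smaller than $i$ and whose greatest element is greater than $i$. $\mathrm{rsb}_{\mathcal{OS}}(\pi')=\sum_i\mathrm{rsb}_i(\pi')$, the sum being over all $i$ that are the least element of some block of $\pi'$ (including singleton blocks). Write $C_i\succ C_j$ if $\min C_i>\max C_j$. $\mathrm{bInv}(\pi')$ is the number of pairs $i<j$ with $C_i\succ C_j$; $\mathrm{bMaj}(\pi')$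 is the sum of all $i$ with $C_i\succ C_{i+1}$. Then $\mathrm{INV}=\mathrm{rsb}_{\mathcal{OS}}+\mathrm{bInv}$ and $\mathrm{MAJ}=\mathrm{rsb}_{\mathcal{OS}}+\mathrm{bMaj}$. $[m]_q=1+q+\cdots+q^{m-1}$ and $[k]_q!=[1]_q[2]_q\cdots[k]_q$. *)

theory Defs
  imports Complex_Main "HOL-Library.Disjoint_Sets" "HOL-Combinatorics.Permutations"
begin

text \<open>
  Positions in a list are numbered from 0, so the block written \<open>C\<^sub>i\<close> in the usual notation
  \<open>C\<^sub>1/\<dots>/C\<^sub>k\<close> is \<open>C ! (i - 1)\<close>.
\<close>

definition ordered_partitions :: "nat \<Rightarrow> nat \<Rightarrow> nat set list set" where
  "ordered_partitions n k =
     {C. length C = k \<and> (\<forall>B \<in> set C. B \<noteq> {}) \<and> \<Union> (set C) = {1..n} \<and>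
         (\<forall>i j. i < j \<longrightarrow> j < length C \<longrightarrow> C ! i \<inter> C ! j = {})}"

definition set_partitions :: "nat \<Rightarrow> nat \<Rightarrow> nat set set set" where
  "set_partitions n k = {\<pi>. partition_on {1..n} \<pi> \<and> card \<pi> = k}"

definition blocks_by_min :: "nat set set \<Rightarrow> nat set list" where
  "blocks_by_min \<pi> = sorted_key_list_of_set Min \<pi>"

definition rearrangement_class :: "nat set set \<Rightarrow> nat set list set" where
  "rearrangement_class \<pi> =
     {permute_list \<sigma> (blocks_by_min \<pi>) |\<sigma>. \<sigma> permutes {..<card \<pi>}}"

text \<open>
  As the blocks of an ordered partition are distinct, blocks are counted by their positions:
  \<open>l\<close> is the position of the block containing \<open>i\<close>, and \<open>j\<close> that of a block to its right.
\<close>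

definition rsb :: "nat set list \<Rightarrow> nat \<Rightarrow> nat" where
  "rsb C i = card {j. j < length C \<and> (\<exists>l<j. i \<in> C ! l) \<and> Min (C ! j) < i \<and> i < Max (C ! j)}"

definition rsb_OS :: "nat set list \<Rightarrow> nat" where
  "rsb_OS C = (\<Sum>i \<in> Min ` set C. rsb C i)"

definition block_gt :: "nat set \<Rightarrow> nat set \<Rightarrow> bool" (infix "\<succ>" 50) where
  "A \<succ> B \<longleftrightarrow> Min A > Max B"

definition bInv :: "nat set list \<Rightarrow> nat" where
  "bInv C = card {(i, j). i < j \<and> j < length C \<and> C ! i \<succ> C ! j}"

definition bMaj :: "nat set list \<Rightarrow> nat" where
  "bMaj C = \<Sum> {i. 1 \<le> i \<and> i < length C \<and> C ! (i - 1) \<succ> C ! i}"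

definition INV :: "nat set list \<Rightarrow> nat" where
  "INV C = rsb_OS C + bInv C"

definition MAJ :: "nat set list \<Rightarrow> nat" where
  "MAJ C = rsb_OS C + bMaj C"

definition q_int :: "'a::comm_ring_1 \<Rightarrow> nat \<Rightarrow> 'a" where
  "q_int q m = (\<Sum>i<m. q ^ i)"

definition q_fact :: "'a::comm_ring_1 \<Rightarrow> nat \<Rightarrow> 'a" where
  "q_fact q k = (\<Prod>m=1..k. q_int q m)"

definition equidistributed_on :: "'b set \<Rightarrow> ('b \<Rightarrow> nat) \<Rightarrow> ('b \<Rightarrow> nat) \<Rightarrow> bool" where
  "equidistributed_on A f g \<longleftrightarrow> (\<forall>m. card {x \<in> A. f x = m} = card {x \<in> A. g x = m})"

text \<open>
  \<^const>\<open>sorted_key_list_of_set\<close> is only meaningful when the key is injective; for the blocks of a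
  set partition, the minimum is.
\<close>

lemma set_partitions_finite:
  assumes "\<pi> \<in> set_partitions n k"
  shows "finite \<pi>" and "\<And>B. B \<in> \<pi> \<Longrightarrow> finite B \<and> B \<noteq> {}"
  using assms unfolding set_partitions_def partition_on_def
  by (auto intro: finite_UnionD finite_subset[OF Union_upper])

lemma inj_on_Min_set_partitions:
  assumes "\<pi> \<in> set_partitions n k"
  shows "inj_on Min \<pi>"
proof (rule inj_onI)
  fix A B assume AB: "A \<in> \<pi>" "B \<in> \<pi>" "Min A = Min B"
  have "Min A \<in> A \<inter> B"
    using AB set_partitions_finite(2)[OF assms] by (metis IntI Min_in)
  moreover have "disjoint \<pi>"
    using assms by (auto simp: set_partitions_def partition_on_def)
  ultimately show "A = B"
    using AB by (auto dest: disjointD)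
qed

lemma (in linorder) sorted_key_list_of_set_inj_on:
  assumes "inj_on f A" and "finite A"
  shows "set (sorted_key_list_of_set f A) = A" and "distinct (sorted_key_list_of_set f A)"
    and "sorted_wrt (<) (map f (sorted_key_list_of_set f A))"
proof -
  interpret fik: folding_insort_key "(\<le>)" "(<)" A f
    by unfold_locales (rule assms(1))
  show "set (sorted_key_list_of_set f A) = A"
    using assms(2) by (intro fik.set_sorted_key_list_of_set) simp_all
  show "distinct (sorted_key_list_of_set f A)"
    using fik.distinct_sorted_key_list_of_set[of A] by (simp add: distinct_map)
  show "sorted_wrt (<) (map f (sorted_key_list_of_set f A))"
    by (intro fik.strict_sorted_key_list_of_set) simp
qed

lemma blocks_by_min:
  assumes "\<pi> \<in> set_partitions n k"
  shows "set (blocks_by_min \<pi>) = \<pi>" and "distinct (blocks_by_min \<pi>)"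
    and "length (blocks_by_min \<pi>) = k" and "sorted_wrt (<) (map Min (blocks_by_min \<pi>))"
proof -
  note * = sorted_key_list_of_set_inj_on
    [OF inj_on_Min_set_partitions[OF assms] set_partitions_finite(1)[OF assms],
     folded blocks_by_min_def]
  show "set (blocks_by_min \<pi>) = \<pi>" "distinct (blocks_by_min \<pi>)"
    "sorted_wrt (<) (map Min (blocks_by_min \<pi>))"
    by (fact *)+
  show "length (blocks_by_min \<pi>) = k"
    using *(1,2) assms by (metis (mono_tags, lifting) distinct_card mem_Collect_eq set_partitions_def)
qed

lemma rearrangement_class_subset:
  assumes "\<pi> \<in> set_partitions n k"
  shows "rearrangement_class \<pi> \<subseteq> ordered_partitions n k"
proof
  fix C assume "C \<in> rearrangement_class \<pi>"
  then obtain \<sigma> where \<sigma>: "\<sigma> permutes {..<card \<pi>}" and C: "C = permute_list \<sigma> (blocks_by_min \<pi>)"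
    by (auto simp: rearrangement_class_def)
  have card: "card \<pi> = k" and part: "partition_on {1..n} \<pi>"
    using assms by (auto simp: set_partitions_def)
  have \<sigma>': "\<sigma> permutes {..<length (blocks_by_min \<pi>)}"
    using \<sigma> card blocks_by_min(3)[OF assms] by simp
  have set: "set C = \<pi>" and len: "length C = k" and dist: "distinct C"
    using C \<sigma>' blocks_by_min[OF assms] by simp_all
  have "C ! i \<inter> C ! j = {}" if "i < j" "j < length C" for i j
  proof -
    have "C ! i \<in> \<pi>" "C ! j \<in> \<pi>" "C ! i \<noteq> C ! j"
      using that set dist nth_mem[of i C] nth_mem[of j C] by (auto simp: nth_eq_iff_index_eq)
    then show ?thesis
      using part by (auto simp: partition_on_def dest: disjointD)
  qed
  then show "C \<in> ordered_partitions n k"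
    using set len part by (auto simp: ordered_partitions_def partition_on_def)
qed

end

theory Submission
  imports Defs "HOL-Combinatorics.Multiset_Permutations" "HOL-Computational_Algebra.Polynomial"
begin

text \<open>
  Write \<open>m\<^sub>A\<close> for the minimum of a block \<open>A\<close>. The rearrangement class of \<open>\<pi>\<close> consists of all words whose
  letters are the blocks of \<open>\<pi>\<close>, each used once; order the letters by their minima. A pair of
  positions \<open>i < j\<close> contributes to \<open>rsb_OS\<close> precisely when it is an inversion of the word for this
  order but not \<open>C\<^sub>i \<succ> C\<^sub>j\<close>. Hence both statistics have the form
  \<open>maj U + inv ((>) - U)\<close>, where the first summand adds up the positions of the descents lying in a
  subrelation \<open>U\<close> of the strict order and the second counts the inversions that do not lie in \<open>U\<close>:
  for \<open>MAJ\<close> the relation \<open>U\<close> is \<open>\<succ>\<close>, and for \<open>INV\<close> it is empty.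

  The only property of \<open>\<succ>\<close> that matters is that it is closed upwards in its first argument: if
  \<open>A \<succ> B\<close> and \<open>m\<^sub>A < m\<^sub>D\<close> then \<open>D \<succ> B\<close>. Under this assumption the generating function is
  \<open>[k]\<^sub>q!\<close>, by induction on the number of letters. Insert a letter \<open>m\<close>, larger than all others,
  into one of the \<open>n + 1\<close> gaps \<open>0, \<dots>, n\<close> of a word \<open>w\<^sub>0 \<dots> w\<^sub>n\<^sub>-\<^sub>1\<close>, gap \<open>p\<close> being the one before \<open>w\<^sub>p\<close>.
  Call gap \<open>p\<close> low if \<open>p = n\<close>, or \<open>U m w\<^sub>p\<close> fails, or there already is a \<open>U\<close>-descent from \<open>w\<^sub>p\<^sub>-\<^sub>1\<close> to
  \<open>w\<^sub>p\<close>. For \<open>p < n\<close>, each low gap to the right of gap \<open>p\<close> except the last adds \<open>1\<close>: it marks a new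
  inversion outside \<open>U\<close> or a \<open>U\<close>-descent shifted by one position. The letter \<open>w\<^sub>p\<close> adds one more, which
  may be credited to the last gap: \<open>w\<^sub>p\<close> forms a new inversion with \<open>m\<close>, or it is the bottom of a
  descent that is replaced by one at the next position, or, if gap \<open>p\<close> is not low, it forms with \<open>m\<close>
  a new descent at position \<open>p + 1\<close>, which is worth \<open>p\<close> beyond this unit. For \<open>p = n\<close> nothing changes.
  So the statistic grows by the number of low gaps beyond \<open>p\<close>, plus \<open>p\<close> if gap \<open>p\<close> itself is not low
  (\<open>maj_inv_append_Cons\<close>), and as \<open>p\<close> varies this increment
  takes each of the values \<open>0, \<dots>, n\<close> exactly once (\<open>bij_betw_card_greater\<close>): low gaps give the small
  values from right to left, the others the large values from left to right. Thus each insertion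
  multiplies the generating function by \<open>[n + 1]\<^sub>q\<close>. Equidistribution is the same identity read off
  coefficientwise for a polynomial indeterminate \<open>q\<close>.
\<close>

section \<open>Descents, major index and inversions for a relation\<close>

text \<open>The number of descents of a word, that is, of adjacent letters related by \<open>R\<close>.\<close>

fun des :: "('b \<Rightarrow> 'b \<Rightarrow> bool) \<Rightarrow> 'b list \<Rightarrow> nat" where
  "des R [] = 0"
| "des R [x] = 0"
| "des R (x # y # xs) = of_bool (R x y) + des R (y # xs)"

text \<open>
  The sum of the positions of the descents, counted from 1. Putting a letter in front moves every
  descent by one position, and a new descent gets position 1; so it adds the number of descents of
  the longer word.
\<close>

fun maj :: "('b \<Rightarrow> 'b \<Rightarrow> bool) \<Rightarrow> 'b list \<Rightarrow> nat" where
  "maj R [] = 0"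
| "maj R (x # xs) = des R (x # xs) + maj R xs"

text \<open>The number of pairs of positions, not necessarily adjacent, whose letters are related by \<open>R\<close>.\<close>

fun ninv :: "('b \<Rightarrow> 'b \<Rightarrow> bool) \<Rightarrow> 'b list \<Rightarrow> nat" where
  "ninv R [] = 0"
| "ninv R (x # xs) = length (filter (R x) xs) + ninv R xs"

lemma ninv_conv_card:
  "ninv R xs = card {(i, j). i < j \<and> j < length xs \<and> R (xs ! i) (xs ! j)}"
proof (induction xs)
  case (Cons x xs)
  let ?S = "{(i, j). i < j \<and> j < length xs \<and> R (xs ! i) (xs ! j)}"
  let ?T = "{j. j < length xs \<and> R x (xs ! j)}"
  have fin: "finite ?S"
    by (rule finite_subset[of _ "{..<length xs} \<times> {..<length xs}"]) auto
  have split: "{(i, j). i < j \<and> j < length (x # xs) \<and> R ((x # xs) ! i) ((x # xs) ! j)} =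
      (\<lambda>j. (0::nat, Suc j)) ` ?T \<union> map_prod Suc Suc ` ?S" (is "?L = ?R")
  proof (rule set_eqI, clarify)
    fix i j
    show "(i, j) \<in> ?L \<longleftrightarrow> (i, j) \<in> ?R"
      by (cases i; cases j) (auto simp: image_iff)
  qed
  have "card ((\<lambda>j. (0::nat, Suc j)) ` ?T) = length (filter (R x) xs)"
    by (subst card_image) (auto simp: inj_on_def length_filter_conv_card)
  moreover have "card (map_prod Suc Suc ` ?S) = card ?S"
    by (rule card_image) (auto simp: inj_on_def)
  moreover have "card ?R = card ((\<lambda>j. (0::nat, Suc j)) ` ?T) + card (map_prod Suc Suc ` ?S)"
    by (rule card_Un_disjoint) (use fin in auto)
  ultimately show ?case
    unfolding split by (simp only: ninv.simps Cons.IH)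
qed simp

lemma ninv_conv_sum:
  "ninv R xs = (\<Sum>i<length xs. card {j. i < j \<and> j < length xs \<and> R (xs ! i) (xs ! j)})"
proof -
  have "{(i, j). i < j \<and> j < length xs \<and> R (xs ! i) (xs ! j)} =
      (SIGMA i:{..<length xs}. {j. i < j \<and> j < length xs \<and> R (xs ! i) (xs ! j)})"
    by auto
  then show ?thesis
    by (simp add: ninv_conv_card)
qed

lemma ninv_add_ninv:
  assumes "\<And>i j. i < j \<Longrightarrow> j < length xs \<Longrightarrow>
      T (xs ! i) (xs ! j) \<longleftrightarrow> R (xs ! i) (xs ! j) \<or> S (xs ! i) (xs ! j)"
    and "\<And>x y. \<not> (R x y \<and> S x y)"
  shows "ninv R xs + ninv S xs = ninv T xs"
proof -
  have fin: "finite {(i, j). i < j \<and> j < length xs \<and> P i j}" for P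
    by (rule finite_subset[of _ "{..<length xs} \<times> {..<length xs}"]) auto
  have "{(i, j). i < j \<and> j < length xs \<and> T (xs ! i) (xs ! j)} =
      {(i, j). i < j \<and> j < length xs \<and> R (xs ! i) (xs ! j)} \<union>
      {(i, j). i < j \<and> j < length xs \<and> S (xs ! i) (xs ! j)}"
    using assms(1) by auto
  then show ?thesis
    unfolding ninv_conv_card by (simp only:) (subst card_Un_disjoint, insert fin assms(2), auto)
qed

lemma descents_Cons:
  "{i. 1 \<le> i \<and> i < length (x # xs) \<and> R ((x # xs) ! (i - 1)) ((x # xs) ! i)} =
     (if xs \<noteq> [] \<and> R x (hd xs) then {1} else {}) \<union>
     Suc ` {i. 1 \<le> i \<and> i < length xs \<and> R (xs ! (i - 1)) (xs ! i)}" (is "?L = ?A \<union> Suc ` ?B")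
proof (rule set_eqI)
  fix i
  consider "i = 0" | "i = 1" | j where "i = Suc (Suc j)"
    by (metis One_nat_def not0_implies_Suc)
  then show "i \<in> ?L \<longleftrightarrow> i \<in> ?A \<union> Suc ` ?B"
    by cases (auto simp: image_iff hd_conv_nth)
qed

lemma des_conv_card:
  "des R xs = card {i. 1 \<le> i \<and> i < length xs \<and> R (xs ! (i - 1)) (xs ! i)}"
proof (induction xs)
  case (Cons x xs)
  have "des R (x # xs) = of_bool (xs \<noteq> [] \<and> R x (hd xs)) + des R xs"
    by (cases xs) auto
  then show ?case
    unfolding descents_Cons by (subst card_Un_disjoint) (auto simp: card_image Cons)
qed simp

lemma maj_conv_sum:
  "maj R xs = \<Sum> {i. 1 \<le> i \<and> i < length xs \<and> R (xs ! (i - 1)) (xs ! i)}"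
proof (induction xs)
  case (Cons x xs)
  let ?B = "{i. 1 \<le> i \<and> i < length xs \<and> R (xs ! (i - 1)) (xs ! i)}"
  have "\<Sum> (Suc ` ?B) = \<Sum> ?B + card ?B"
    by (simp add: sum.reindex sum.distrib Suc_eq_plus1 del: One_nat_def)
  moreover have "des R (x # xs) = of_bool (xs \<noteq> [] \<and> R x (hd xs)) + des R xs"
    by (cases xs) auto
  ultimately show ?case
    unfolding descents_Cons
    by (subst sum.union_disjoint) (auto simp: Cons des_conv_card[of R xs])
qed simp

section \<open>Inserting a letter into all permutations of a set\<close>

text \<open>The word in which \<open>x\<close> has exactly \<open>p\<close> letters before it, for \<open>p \<le> length xs\<close>.\<close>

definition insert_at :: "'b \<Rightarrow> nat \<Rightarrow> 'b list \<Rightarrow> 'b list" where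
  "insert_at x p xs = take p xs @ x # drop p xs"

lemma sum_permutations_of_set_insert:
  fixes g :: "'b list \<Rightarrow> 'c::comm_monoid_add"
  assumes "finite A" and "x \<notin> A"
  shows "(\<Sum>w \<in> permutations_of_set (insert x A). g w) =
    (\<Sum>xs \<in> permutations_of_set A. \<Sum>p\<le>card A. g (insert_at x p xs))"
proof -
  have remove: "remove1 x (take p xs @ x # drop p xs) = xs" if "x \<notin> set xs" for p xs
    using that by (auto simp: remove1_append dest: in_set_takeD)
  have front: "length (takeWhile (\<lambda>y. y \<noteq> x) (take p xs @ x # drop p xs)) = p"
    if "x \<notin> set xs" "p \<le> length xs" for p xs
    using that by (subst takeWhile_append2) (auto dest: in_set_takeD)
  have restore: "insert_at x (length (takeWhile (\<lambda>y. y \<noteq> x) w)) (remove1 x w) = w"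
    if x: "x \<in> set w" for w
  proof -
    obtain us vs where "w = us @ x # vs" "x \<notin> set us"
      using split_list_first[OF x] by blast
    then show ?thesis
      by (simp add: insert_at_def remove1_append takeWhile_append)
  qed
  have len: "length xs = card A" if "xs \<in> permutations_of_set A" for xs
    using that by (rule length_finite_permutations_of_set)
  have "(\<Sum>w \<in> permutations_of_set (insert x A). g w) =
    (\<Sum>(xs, p) \<in> permutations_of_set A \<times> {..card A}. g (insert_at x p xs))"
  proof (rule sum.reindex_bij_witness[where
        i = "\<lambda>(xs, p). insert_at x p xs" and
        j = "\<lambda>w. (remove1 x w, length (takeWhile (\<lambda>y. y \<noteq> x) w))"])
    fix w assume w: "w \<in> permutations_of_set (insert x A)"
    then have x: "x \<in> set w"
      by (auto simp: permutations_of_set_def)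
    show "(case (remove1 x w, length (takeWhile (\<lambda>y. y \<noteq> x) w)) of (xs, p) \<Rightarrow> insert_at x p xs) = w"
      using restore[OF x] by simp
    then show "(case (remove1 x w, length (takeWhile (\<lambda>y. y \<noteq> x) w)) of
        (xs, p) \<Rightarrow> g (insert_at x p xs)) = g w"
      by simp
    have 1: "remove1 x w \<in> permutations_of_set A"
      using w assms by (auto simp: permutations_of_set_def)
    have "dropWhile (\<lambda>y. y \<noteq> x) w \<noteq> []"
      using x by simp
    moreover have "length w = length (takeWhile (\<lambda>y. y \<noteq> x) w) + length (dropWhile (\<lambda>y. y \<noteq> x) w)"
      by (metis length_append takeWhile_dropWhile_id)
    ultimately have "length (takeWhile (\<lambda>y. y \<noteq> x) w) < length w"
      by (metis length_greater_0_conv less_add_same_cancel1)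
    moreover have "length w = Suc (card A)"
      using length_finite_permutations_of_set[OF w] assms by simp
    ultimately show "(remove1 x w, length (takeWhile (\<lambda>y. y \<noteq> x) w)) \<in>
        permutations_of_set A \<times> {..card A}"
      using 1 by simp
  next
    fix b assume "b \<in> permutations_of_set A \<times> {..card A}"
    then obtain xs p where b: "b = (xs, p)" "xs \<in> permutations_of_set A" "p \<le> card A"
      by auto
    have x: "x \<notin> set xs"
      using b assms by (auto simp: permutations_of_set_def)
    show "(remove1 x (case b of (xs, p) \<Rightarrow> insert_at x p xs),
        length (takeWhile (\<lambda>y. y \<noteq> x) (case b of (xs, p) \<Rightarrow> insert_at x p xs))) = b"
      using b x remove[OF x] front[OF x] len by (simp add: insert_at_def)
    have "set (take p xs) \<union> set (drop p xs) = set xs"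
      by (metis append_take_drop_id set_append)
    moreover have "set (take p xs) \<inter> set (drop p xs) = {}"
      using b by (intro set_take_disj_set_drop_if_distinct) (auto simp: permutations_of_set_def)
    ultimately show "(case b of (xs, p) \<Rightarrow> insert_at x p xs) \<in> permutations_of_set (insert x A)"
      using b x by (auto simp: permutations_of_set_def insert_at_def)
  qed
  then show ?thesis
    by (simp add: sum.cartesian_product)
qed

section \<open>Increments given by counting marked gaps\<close>

text \<open>
  With \<open>t\<close> elements of \<open>T\<close> among \<open>0, \<dots>, n\<close>, the function decreases on these from \<open>t - 1\<close> to \<open>0\<close>. At
  \<open>p \<notin> T\<close> its value is \<open>n\<close> minus the number of later non-elements, so on the non-elements it
  increases from \<open>t\<close> to \<open>n\<close>.
\<close>

lemma bij_betw_card_greater: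
  fixes T :: "nat set" and n :: nat
  defines "d \<equiv> \<lambda>p. card {j \<in> T. p < j \<and> j \<le> n} + (if p \<in> T then 0 else p)"
  shows "bij_betw d {..n} {..n}"
proof -
  define c where "c p = card {j \<in> T. p < j \<and> j \<le> n}" for p
  define c' where "c' p = card {j \<in> - T. p < j \<and> j \<le> n}" for p
  have sum: "c p + c' p = n - p" for p
  proof -
    have "c p + c' p = card ({j \<in> T. p < j \<and> j \<le> n} \<union> {j \<in> - T. p < j \<and> j \<le> n})"
      unfolding c_def c'_def by (subst card_Un_disjoint) auto
    also have "{j \<in> T. p < j \<and> j \<le> n} \<union> {j \<in> - T. p < j \<and> j \<le> n} = {p<..n}"
      by auto
    finally show ?thesis by simp
  qed
  have total: "card {j \<in> T. j \<le> n} + card {j \<in> - T. j \<le> n} = Suc n"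
  proof -
    have "card {j \<in> T. j \<le> n} + card {j \<in> - T. j \<le> n} = card ({j \<in> T. j \<le> n} \<union> {j \<in> - T. j \<le> n})"
      by (subst card_Un_disjoint) auto
    also have "{j \<in> T. j \<le> n} \<union> {j \<in> - T. j \<le> n} = {..n}"
      by auto
    finally show ?thesis by simp
  qed
  have d: "d p = (if p \<in> T then c p else n - c' p)" "c' p \<le> n - p" if "p \<le> n" for p
    using that sum[of p] by (auto simp: d_def c_def)
  have c_less: "c p' < c p" if "p < p'" "p' \<in> T" "p' \<le> n" for p p'
    unfolding c_def using that by (intro psubset_card_mono) auto
  have c'_less: "c' p' < c' p" if "p < p'" "p' \<notin> T" "p' \<le> n" for p p'
    unfolding c'_def using that by (intro psubset_card_mono) auto
  have low: "c p < card {j \<in> T. j \<le> n}" if "p \<in> T" "p \<le> n" for p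
    unfolding c_def using that by (intro psubset_card_mono) auto
  have high: "c' p < card {j \<in> - T. j \<le> n}" if "p \<notin> T" "p \<le> n" for p
    unfolding c'_def using that by (intro psubset_card_mono) auto
  have neq: "d p \<noteq> d p'" if "p < p'" "p' \<le> n" for p p'
  proof -
    have "p \<le> n"
      using that by simp
    then show ?thesis
      using that c_less[of p p'] c'_less[of p p'] low[of p] low[of p'] high[of p] high[of p'] total
        d[of p] d[of p'] by (cases "p \<in> T"; cases "p' \<in> T") simp_all
  qed
  have "inj_on d {..n}"
    by (rule inj_onI) (metis neq atMost_iff linorder_neqE_nat)
  moreover have "d ` {..n} \<subseteq> {..n}"
  proof (rule image_subsetI)
    fix p assume "p \<in> {..n}"
    then show "d p \<in> {..n}"
      using d(1)[of p] sum[of p] by (cases "p \<in> T") simp_all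
  qed
  ultimately show ?thesis
    by (simp add: bij_betw_def endo_inj_surj)
qed

section \<open>The mixed major index of a threshold relation\<close>

text \<open>
  Letters are ordered by the key \<open>f\<close>. For each \<open>y\<close>, all letters \<open>x\<close> with \<open>U x y\<close> have keys above that
  of \<open>y\<close>, and with each such \<open>x\<close> every letter of larger key is related to \<open>y\<close> as well.
\<close>

locale threshold_relation =
  fixes f :: "'b \<Rightarrow> 'c::linorder" and U :: "'b \<Rightarrow> 'b \<Rightarrow> bool"
  assumes U_less: "U x y \<Longrightarrow> f y < f x"
    and U_mono: "U x y \<Longrightarrow> f x < f z \<Longrightarrow> U z y"
begin

text \<open>Inversions that lie in \<open>U\<close> count as for the major index, the others one each.\<close>

definition maj_inv :: "'b list \<Rightarrow> nat" where
  "maj_inv w = maj U w + ninv (\<lambda>x y. f y < f x \<and> \<not> U x y) w"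

text \<open>
  The gap between adjacent letters \<open>x\<close> and \<open>y\<close> is low for \<open>m\<close> if \<open>\<not> U m y\<close> or \<open>U x y\<close>; the gap at the end
  of the word is always low. This counts the low gaps to the right of the first letter; the gap in
  front of the word, whose status depends on the letter preceding it, is left out.
\<close>

fun low_gaps :: "'b \<Rightarrow> 'b list \<Rightarrow> nat" where
  "low_gaps m [] = 0"
| "low_gaps m [x] = 1"
| "low_gaps m (x # y # xs) = of_bool (\<not> U m y \<or> U x y) + low_gaps m (y # xs)"

lemma des_append_Cons:
  assumes "us \<noteq> []" and "\<And>x. x \<in> set (us @ vs) \<Longrightarrow> f x < f m"
  shows "des U (us @ m # vs) =
    des U (us @ vs) + of_bool (vs \<noteq> [] \<and> U m (hd vs) \<and> \<not> U (last us) (hd vs))"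
  using assms
proof (induction us rule: induct_list012)
  case (2 u)
  have "\<not> U u m"
    using 2 U_less by (metis append_Cons list.set_intros(1) order_less_asym)
  moreover have "U u (hd vs) \<Longrightarrow> U m (hd vs)"
    using 2 U_mono by auto
  ultimately show ?case
    by (cases vs) auto
qed auto

text \<open>
  The right-hand side is the growth of the statistic when \<open>m\<close> is put in front of \<open>vs\<close>. At a low gap
  between letters \<open>x\<close> and \<open>y\<close> of \<open>vs\<close>, either \<open>m\<close> and \<open>y\<close> form an inversion outside \<open>U\<close> or \<open>x\<close> and \<open>y\<close>
  form a descent, never both, by monotonicity of \<open>U\<close>. The final gap makes up for the first letter of
  \<open>vs\<close>, which forms with \<open>m\<close> either a descent or an inversion outside \<open>U\<close>.
\<close>

lemma low_gaps_conv:
  assumes "\<And>x. x \<in> set vs \<Longrightarrow> f x < f m"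
  shows "low_gaps m vs = des U (m # vs) + length (filter (\<lambda>y. f y < f m \<and> \<not> U m y) vs)"
  using assms
proof (induction m vs rule: low_gaps.induct)
  case (3 m x y xs)
  have "U x y \<Longrightarrow> U m y"
    using 3 U_mono by auto
  then show ?case
    using 3 by auto
qed auto

text \<open>
  The final summand is nonzero just when the gap between \<open>us\<close> and \<open>vs\<close> is not low and \<open>us\<close> is nonempty.
  It arises because each letter of \<open>us\<close> then starts a suffix with one descent more than before.
\<close>

lemma maj_inv_append_Cons:
  assumes "\<And>x. x \<in> set (us @ vs) \<Longrightarrow> f x < f m"
  shows "maj_inv (us @ m # vs) = maj_inv (us @ vs) + low_gaps m vs +
    of_bool (vs \<noteq> [] \<and> U m (hd vs) \<and> (us = [] \<or> \<not> U (last us) (hd vs))) * length us"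
  using assms
proof (induction us)
  case Nil
  then show ?case
    using low_gaps_conv[of vs m] by (simp add: maj_inv_def)
next
  case (Cons u us)
  \<comment> \<open>The letter \<open>u\<close> forms no inversion with \<open>m\<close>, so its share changes only through descents.\<close>
  have "\<not> f m < f u"
    using Cons.prems[of u] by auto
  then have "maj_inv ((u # us) @ m # vs) = maj_inv (us @ m # vs) + des U ((u # us) @ m # vs) +
      length (filter (\<lambda>y. f y < f u \<and> \<not> U u y) (us @ vs))"
    by (simp add: maj_inv_def)
  moreover have "maj_inv ((u # us) @ vs) = maj_inv (us @ vs) + des U ((u # us) @ vs) +
      length (filter (\<lambda>y. f y < f u \<and> \<not> U u y) (us @ vs))"
    by (simp add: maj_inv_def)
  ultimately show ?case
    using Cons.IH Cons.prems des_append_Cons[of "u # us" vs m] by (cases "us = []") auto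
qed

lemma bij_betw_maj_inv_insert_at:
  assumes "\<And>x. x \<in> set xs \<Longrightarrow> f x < f m"
  obtains d where "bij_betw d {..length xs} {..length xs}"
    and "\<And>p. p \<le> length xs \<Longrightarrow> maj_inv (insert_at m p xs) = maj_inv xs + d p"
proof -
  define n where "n = length xs"
  \<comment> \<open>\<open>T\<close> is the set of low gaps.\<close>
  define T where "T = {p. p = n \<or> p < n \<and> (\<not> U m (xs ! p) \<or> 0 < p \<and> U (xs ! (p - 1)) (xs ! p))}"
  define d where "d p = card {j \<in> T. p < j \<and> j \<le> n} + (if p \<in> T then 0 else p)" for p
  have low: "low_gaps m (drop p xs) = card {j \<in> T. p < j \<and> j \<le> n}" if "p \<le> n" for p
    using that
  proof (induction rule: inc_induct)
    case base
    then show ?case by (simp add: n_def)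
  next
    case (step p)
    have "{j \<in> T. p < j \<and> j \<le> n} =
        (if Suc p \<in> T then {Suc p} else {}) \<union> {j \<in> T. Suc p < j \<and> j \<le> n}"
      using step by (auto intro!: Suc_lessI)
    then have card: "card {j \<in> T. p < j \<and> j \<le> n} =
        of_bool (Suc p \<in> T) + card {j \<in> T. Suc p < j \<and> j \<le> n}"
      by simp
    have drop: "drop p xs = xs ! p # drop (Suc p) xs"
      using step by (simp add: Cons_nth_drop_Suc n_def)
    show ?case
    proof (cases "Suc p = n")
      case True
      then show ?thesis
        using drop card step by (auto simp: n_def T_def)
    next
      case False
      then have "drop (Suc p) xs = xs ! Suc p # drop (Suc (Suc p)) xs"
        using step by (simp add: Cons_nth_drop_Suc n_def)
      then have "low_gaps m (drop p xs) = of_bool (Suc p \<in> T) + low_gaps m (drop (Suc p) xs)"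
        using drop False step by (auto simp: T_def)
      then show ?thesis
        using card step by simp
    qed
  qed
  have "maj_inv (insert_at m p xs) = maj_inv xs + d p" if p: "p \<le> n" for p
  proof -
    have "last (take p xs) = xs ! (p - 1)" if "0 < p"
      using p that by (subst last_conv_nth) (auto simp: n_def min_def)
    then have "p \<notin> T \<longleftrightarrow> drop p xs \<noteq> [] \<and> U m (hd (drop p xs)) \<and>
        (take p xs = [] \<or> \<not> U (last (take p xs)) (hd (drop p xs)))"
      using p by (auto simp: T_def n_def hd_drop_conv_nth hd_conv_nth)
    then show ?thesis
      using maj_inv_append_Cons[of "take p xs" "drop p xs" m] assms p low[OF p]
      by (auto simp: insert_at_def d_def n_def)
  qed
  moreover have "bij_betw d {..n} {..n}"
    unfolding d_def by (rule bij_betw_card_greater)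
  ultimately show thesis
    using that by (simp add: n_def)
qed

theorem sum_power_maj_inv:
  fixes q :: "'a::comm_ring_1"
  assumes "finite A" and "inj_on f A"
  shows "(\<Sum>w \<in> permutations_of_set A. q ^ maj_inv w) = q_fact q (card A)"
  using assms
proof (induction A rule: finite_ranking_induct[where f = f])
  case empty
  then show ?case by (simp add: maj_inv_def q_fact_def)
next
  case (insert m A)
  show ?case
  proof (cases "m \<in> A")
    case True
    then show ?thesis
      using insert by (simp add: insert_absorb)
  next
    case False
    have less: "f x < f m" if "x \<in> A" for x
      using insert that False by (metis inj_on_def insertCI order_le_neq_trans)
    have "(\<Sum>p\<le>card A. q ^ maj_inv (insert_at m p xs)) = q ^ maj_inv xs * q_int q (Suc (card A))"
      if xs: "xs \<in> permutations_of_set A" for xs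
    proof -
      have set: "set xs = A" and len: "length xs = card A"
        using xs by (auto simp: permutations_of_set_def distinct_card)
      obtain d where d: "bij_betw d {..card A} {..card A}"
        "\<And>p. p \<le> card A \<Longrightarrow> maj_inv (insert_at m p xs) = maj_inv xs + d p"
        using bij_betw_maj_inv_insert_at[of xs m] less set len by metis
      have "(\<Sum>p\<le>card A. q ^ maj_inv (insert_at m p xs)) = q ^ maj_inv xs * (\<Sum>p\<le>card A. q ^ d p)"
        by (simp add: d(2) power_add sum_distrib_left)
      also have "(\<Sum>p\<le>card A. q ^ d p) = (\<Sum>i\<le>card A. q ^ i)"
        by (rule sum.reindex_bij_betw[OF d(1)])
      finally show ?thesis
        by (simp add: q_int_def lessThan_Suc_atMost)
    qed
    then have "(\<Sum>w \<in> permutations_of_set (insert m A). q ^ maj_inv w) =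
        (\<Sum>xs \<in> permutations_of_set A. q ^ maj_inv xs) * q_int q (Suc (card A))"
      using insert.hyps False by (simp add: sum_permutations_of_set_insert sum_distrib_right)
    then show ?thesis
      using insert False by (simp add: q_fact_def)
  qed
qed

end

section \<open>Rearrangement classes\<close>

lemma rearrangement_class_conv:
  assumes "\<pi> \<in> set_partitions n k"
  shows "rearrangement_class \<pi> = permutations_of_set \<pi>"
proof (rule set_eqI)
  fix C
  note B = blocks_by_min[OF assms]
  have k: "card \<pi> = length (blocks_by_min \<pi>)"
    using assms B(3) by (simp add: set_partitions_def)
  have "C \<in> rearrangement_class \<pi> \<longleftrightarrow> mset C = mset (blocks_by_min \<pi>)"
  proof
    assume "C \<in> rearrangement_class \<pi>"
    then show "mset C = mset (blocks_by_min \<pi>)"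
      unfolding rearrangement_class_def k by auto
  next
    assume "mset C = mset (blocks_by_min \<pi>)"
    then obtain \<sigma> where "\<sigma> permutes {..<length (blocks_by_min \<pi>)}"
      "permute_list \<sigma> (blocks_by_min \<pi>) = C"
      by (rule mset_eq_permutation)
    then show "C \<in> rearrangement_class \<pi>"
      unfolding rearrangement_class_def k by blast
  qed
  also have "\<dots> \<longleftrightarrow> distinct C \<and> set C = \<pi>"
    using B(1,2) set_eq_iff_mset_eq_distinct[of C] mset_eq_imp_distinct_iff mset_eq_setD by metis
  also have "\<dots> \<longleftrightarrow> C \<in> permutations_of_set \<pi>"
    by (auto simp: permutations_of_set_def)
  finally show "C \<in> rearrangement_class \<pi> \<longleftrightarrow> C \<in> permutations_of_set \<pi>" .
qed

text \<open>
  On nonempty finite blocks this is \<open>A \<succ> B\<close>. The first conjunct keeps the relation inside the strict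
  order of minima for arbitrary sets as well, where \<open>Min B \<le> Max B\<close> may fail.
\<close>

definition strictly_after :: "nat set \<Rightarrow> nat set \<Rightarrow> bool" where
  "strictly_after A B \<longleftrightarrow> Min B < Min A \<and> A \<succ> B"

interpretation strict: threshold_relation Min strictly_after
  by unfold_locales (auto simp: strictly_after_def block_gt_def)

text \<open>The empty relation turns the mixed statistic into the number of inversions.\<close>

interpretation none: threshold_relation "Min :: nat set \<Rightarrow> nat" "\<lambda>_ _. False"
  by unfold_locales auto

lemma maj_none: "maj (\<lambda>_ _. False) xs = 0"
  by (simp add: maj_conv_sum)

lemma
  assumes "\<pi> \<in> set_partitions n k" and "C \<in> permutations_of_set \<pi>"
  shows rsb_OS_conv: "rsb_OS C = ninv (\<lambda>A B. Min B < Min A \<and> \<not> strictly_after A B) C"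
    and INV_conv: "INV C = none.maj_inv C"
    and MAJ_conv: "MAJ C = strict.maj_inv C"
proof -
  have set: "set C = \<pi>" and dist: "distinct C"
    using assms(2) by (auto simp: permutations_of_set_def)
  have block: "finite (C ! i)" "C ! i \<noteq> {}" if "i < length C" for i
    using set_partitions_finite(2)[OF assms(1)] set that by (metis nth_mem)+
  have part: "disjoint \<pi>"
    using assms(1) by (simp add: set_partitions_def partition_on_def)
  have same: "i = j" if "x \<in> C ! i" "x \<in> C ! j" "i < length C" "j < length C" for x i j
    using part that set dist by (metis disjointD disjoint_iff nth_eq_iff_index_eq nth_mem)
  have Min_in: "Min (C ! i) \<in> C ! i" and Max_in: "Max (C ! i) \<in> C ! i"
    and Min_le: "Min (C ! i) \<le> Max (C ! i)" if "i < length C" for i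
    using block[OF that] by auto
  have after: "strictly_after (C ! i) (C ! j) \<longleftrightarrow> C ! i \<succ> C ! j"
    if "i < length C" "j < length C" for i j
    using Min_le[OF that(2)] by (auto simp: strictly_after_def block_gt_def)
  have overlap: "Min (C ! j) < Min (C ! i) \<and> Min (C ! i) < Max (C ! j) \<longleftrightarrow>
      Min (C ! j) < Min (C ! i) \<and> \<not> strictly_after (C ! i) (C ! j)"
    if "i < j" "j < length C" for i j
  proof -
    \<comment> \<open>Distinct blocks are disjoint, so the two possible comparisons are strict.\<close>
    have "Min (C ! i) \<noteq> Max (C ! j)"
      using same[of "Min (C ! i)" i j] Min_in[of i] Max_in[of j] that by auto
    then show ?thesis
      using that by (auto simp: after block_gt_def)
  qed
  have "rsb C (Min (C ! i)) =
      card {j. i < j \<and> j < length C \<and> Min (C ! j) < Min (C ! i) \<and> \<not> strictly_after (C ! i) (C ! j)}"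
    if i: "i < length C" for i
  proof -
    have "(\<exists>l<j. Min (C ! i) \<in> C ! l) \<longleftrightarrow> i < j" if "j < length C" for j
      using same[of "Min (C ! i)" i] Min_in[OF i] i that by (metis order_less_trans)
    then have "{j. j < length C \<and> (\<exists>l<j. Min (C ! i) \<in> C ! l) \<and>
          Min (C ! j) < Min (C ! i) \<and> Min (C ! i) < Max (C ! j)} =
        {j. i < j \<and> j < length C \<and> Min (C ! j) < Min (C ! i) \<and> \<not> strictly_after (C ! i) (C ! j)}"
      using overlap by blast
    then show ?thesis
      by (simp add: rsb_def)
  qed
  moreover have "rsb_OS C = (\<Sum>i<length C. rsb C (Min (C ! i)))"
  proof -
    have "inj_on (\<lambda>i. Min (C ! i)) {..<length C}"
      using same Min_in by (metis (no_types, lifting) inj_onI lessThan_iff)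
    moreover have "Min ` set C = (\<lambda>i. Min (C ! i)) ` {..<length C}"
      by (auto simp: set_conv_nth)
    ultimately show ?thesis
      unfolding rsb_OS_def by (simp add: sum.reindex)
  qed
  ultimately show rsb: "rsb_OS C = ninv (\<lambda>A B. Min B < Min A \<and> \<not> strictly_after A B) C"
    by (simp add: ninv_conv_sum)
  have "bInv C = ninv strictly_after C"
    unfolding bInv_def ninv_conv_card using after by (intro arg_cong[where f = card]) auto
  moreover have "ninv (\<lambda>A B. Min B < Min A \<and> \<not> strictly_after A B) C + ninv strictly_after C =
      ninv (\<lambda>A B. Min B < Min A) C"
    by (rule ninv_add_ninv) (auto simp: strictly_after_def)
  ultimately show "INV C = none.maj_inv C"
    by (simp add: INV_def rsb none.maj_inv_def maj_none)
  have "bMaj C = maj strictly_after C"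
    unfolding bMaj_def maj_conv_sum using after by (intro arg_cong[where f = "\<Sum>"]) auto
  then show "MAJ C = strict.maj_inv C"
    by (simp add: MAJ_def rsb strict.maj_inv_def)
qed

section \<open>Equidistribution from generating functions\<close>

text \<open>The polynomial \<open>[:0, 1:]\<close> is the indeterminate over the integers.\<close>

lemma equidistributed_onI_sum_power:
  assumes "finite A"
    and "(\<Sum>x\<in>A. [:0, 1 :: int:] ^ f x) = (\<Sum>x\<in>A. [:0, 1:] ^ g x)"
  shows "equidistributed_on A f g"
  unfolding equidistributed_on_def
proof
  fix m
  have count: "coeff (\<Sum>x\<in>A. [:0, 1 :: int:] ^ h x) m = int (card {x \<in> A. h x = m})" for h
  proof -
    have "coeff (\<Sum>x\<in>A. [:0, 1 :: int:] ^ h x) m = (\<Sum>x\<in>A. if h x = m then 1 else 0)"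
      by (simp add: coeff_sum flip: monom_altdef[of 1, simplified])
    then show ?thesis
      using assms(1) by (simp add: sum.If_cases Int_def)
  qed
  show "card {x \<in> A. f x = m} = card {x \<in> A. g x = m}"
    using count[of f] count[of g] assms(2) by simp
qed

section \<open>Equidistribution of the two statistics\<close>

theorem theorem3p5:
  fixes n k :: nat and \<pi> :: "nat set set" and q :: "'a::comm_ring_1"
  assumes "n \<ge> k" and "k \<ge> 1" and "\<pi> \<in> set_partitions n k"
  shows "equidistributed_on (rearrangement_class \<pi>) INV MAJ \<and>
    (\<Sum>\<pi>' \<in> rearrangement_class \<pi>. q ^ MAJ \<pi>') = (\<Sum>\<pi>' \<in> rearrangement_class \<pi>. q ^ INV \<pi>') \<and>
    (\<Sum>\<pi>' \<in> rearrangement_class \<pi>. q ^ INV \<pi>') = q_fact q k"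
proof -
  note \<pi> = assms(3)
  have fin: "finite \<pi>" and k: "card \<pi> = k"
    using set_partitions_finite(1)[OF \<pi>] \<pi> by (auto simp: set_partitions_def)
  have INV: "(\<Sum>C \<in> rearrangement_class \<pi>. x ^ INV C) = q_fact x k" for x :: "'b::comm_ring_1"
    using none.sum_power_maj_inv[OF fin inj_on_Min_set_partitions[OF \<pi>], of x] k
    by (simp add: rearrangement_class_conv[OF \<pi>] INV_conv[OF \<pi>])
  have MAJ: "(\<Sum>C \<in> rearrangement_class \<pi>. x ^ MAJ C) = q_fact x k" for x :: "'b::comm_ring_1"
    using strict.sum_power_maj_inv[OF fin inj_on_Min_set_partitions[OF \<pi>], of x] k
    by (simp add: rearrangement_class_conv[OF \<pi>] MAJ_conv[OF \<pi>])
  have "finite (rearrangement_class \<pi>)"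
    by (simp add: rearrangement_class_conv[OF \<pi>])
  then have "equidistributed_on (rearrangement_class \<pi>) INV MAJ"
    by (rule equidistributed_onI_sum_power) (simp add: INV MAJ)
  then show ?thesis
    by (simp add: INV MAJ)
qed

end
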